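(* There is an absolute constant $K>0$ such that the following holds. Let $p\in[2,+\infty)$, $\alpha_p>0$, $\epsilon>0$, let $\mathcal{C}\subset\mathbb{R}^n$ be a nonempty compact convex set that is $\alpha_p$-strongly convex with respect to the $\ell_p$-norm, let $x^*\in\mathcal{C}$, let $D_p=\max_{x,y\in\mathcal{C}}\|y-x\|_p$, and let $f(x)=\frac12\|x-x^*\|_p^2$ for $x\in\mathbb{R}^n$. Run the Frank-Wolfe algorithm on $\min_{x\in\mathcal{C}}f(x)$, started at an arbitrary vertex of $\mathcal{C}$, with the closed-loop step-size strategy. Then the algorithm produces an iterate $x\in\mathcal{C}$ satisfying $\|x-x^*\|_p\leq\epsilon$ whose cardinality is $\mathcal{O}\left((\sqrt{p}D_p+p/\alpha_p)/\epsilon\right)$, i.e. at most $K\max\{1,(\sqrt{p}D_p+p/\alpha_p)/\epsilon\}$.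
   Context: $\|\cdot\|_p$ is the $\ell_p$-norm on $\mathbb{R}^n$ and $\langle\cdot,\cdot\rangle$ the Euclidean inner product. Vertices of $\mathcal{C}$ are its extreme points. A set $\mathcal{C}$ is $\alpha$-strongly convex with respect to a norm $\|\cdot\|$ if $\alpha>0$ and for all $x,y\in\mathcal{C}$, $\gamma\in[0,1]$, and $z\in\mathbb{R}^n$ with $\|z\|=1$, we have $(1-\gamma)x+\gamma y+(1-\gamma)\gamma\alpha\|x-y\|^2z\in\mathcal{C}$. Frank-Wolfe algorithm (FW) for a differentiable function $f$ over $\mathcal{C}$: start at a vertex $x_0$ of $\mathcal{C}$; for $t=0,1,2,\ldots$ let $v_t$ be a vertex of $\mathcal{C}$ belonging to $\arg\min_{v\in\mathcal{C}}\langle v,\nabla f(x_t)\rangle$, and set $x_{t+1}=x_t+\gamma_t(v_t-x_t)$ with $\gamma_t\in[0,1]$. Here $f$ is differentiable, $\nabla f(x^* )=0$, and for $x\neq x^*$ the $i$-th entry of $\nabla f(x)$ is $\|x-x^*\|_p^{2-p}\operatorname{sign}([x-x^*]_i)|[x-x^*]_i|^{p-1}$. Closed-loop strategy: $\gamma_t=\min\left\{\frac{\langle x_t-v_t,\nabla f(x_t)\rangle}{(p-1)\|x_t-v_t\|_p^2},1\right\}$ (if $v_t=x_t$, the value of $\gamma_t$ is irrelevant). Each iterate $x_{t+1}=(1-\gamma_t)x_t+\gamma_tv_t$ comes with an explicit convex decomposition over $x_0,v_0,\ldots,v_t$. The cardinality of an iterate is the number of distinct vertices with positive weight in this decomposition.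 *)

theory Defs
  imports "HOL-Analysis.Analysis" "HOL-Analysis.Finite_Function_Topology"
begin

text \<open>
  The dimension has to be a variable of the logic, because one constant serves all dimensions.
  Hence \<open>\<real>\<^sup>n\<close> is the subspace of those finitely supported sequences that vanish from index
  \<open>n\<close> on.  The library norm of \<open>nat \<Rightarrow>\<^sub>0 real\<close> is the \<open>\<ell>\<^sub>1\<close>-norm, so on this subspace its
  topology is the usual one.
\<close>

type_synonym rvec = "nat \<Rightarrow>\<^sub>0 real"

definition euclid :: "nat \<Rightarrow> rvec set" where
  "euclid n = {x. Poly_Mapping.keys x \<subseteq> {..<n}}"

definition lp_norm :: "real \<Rightarrow> rvec \<Rightarrow> real" where
  "lp_norm p x =
     (\<Sum>i\<in>Poly_Mapping.keys x. \<bar>Poly_Mapping.lookup x i\<bar> powr p) powr (1 / p)"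

definition dot :: "rvec \<Rightarrow> rvec \<Rightarrow> real" where
  "dot x y = (\<Sum>i\<in>Poly_Mapping.keys x \<inter> Poly_Mapping.keys y.
     Poly_Mapping.lookup x i * Poly_Mapping.lookup y i)"

text \<open>
  The derivative is taken within \<open>\<real>\<^sup>n\<close>; together with \<open>g \<in> euclid n\<close> this determines \<open>g\<close>.
\<close>

definition gradient :: "nat \<Rightarrow> (rvec \<Rightarrow> real) \<Rightarrow> rvec \<Rightarrow> rvec" where
  "gradient n f x =
     (THE g. g \<in> euclid n \<and> (f has_derivative (\<lambda>h. dot g h)) (at x within euclid n))"

definition strongly_convex_set :: "nat \<Rightarrow> real \<Rightarrow> (rvec \<Rightarrow> real) \<Rightarrow> rvec set \<Rightarrow> bool" where
  "strongly_convex_set n \<alpha> N C \<longleftrightarrow> \<alpha> > 0 \<and>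
     (\<forall>x\<in>C. \<forall>y\<in>C. \<forall>\<gamma>\<in>{0..1}. \<forall>z\<in>euclid n. N z = 1 \<longrightarrow>
        (1 - \<gamma>) *\<^sub>R x + \<gamma> *\<^sub>R y + ((1 - \<gamma>) * \<gamma> * \<alpha> * (N (x - y))\<^sup>2) *\<^sub>R z \<in> C)"

definition lp_diameter :: "real \<Rightarrow> rvec set \<Rightarrow> real" where
  "lp_diameter p C = (GREATEST d. \<exists>x\<in>C. \<exists>y\<in>C. d = lp_norm p (y - x))"

text \<open>
  \<open>x\<close>, \<open>v\<close>, \<open>\<gamma>\<close> are the sequences of iterates, chosen vertices and step sizes.  The predicate
  leaves the choice among several minimizing vertices open.
\<close>

definition frank_wolfe_run ::
  "nat \<Rightarrow> rvec set \<Rightarrow> (rvec \<Rightarrow> real) \<Rightarrow> (nat \<Rightarrow> rvec) \<Rightarrow> (nat \<Rightarrow> rvec) \<Rightarrow> (nat \<Rightarrow> real) \<Rightarrow> bool" where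
  "frank_wolfe_run n C f x v \<gamma> \<longleftrightarrow>
     x 0 extreme_point_of C \<and>
     (\<forall>t. v t extreme_point_of C \<and>
          is_arg_min (\<lambda>w. dot w (gradient n f (x t))) (\<lambda>w. w \<in> C) (v t) \<and>
          \<gamma> t \<in> {0..1} \<and>
          x (Suc t) = x t + \<gamma> t *\<^sub>R (v t - x t))"

definition closed_loop ::
  "nat \<Rightarrow> real \<Rightarrow> (rvec \<Rightarrow> real) \<Rightarrow> (nat \<Rightarrow> rvec) \<Rightarrow> (nat \<Rightarrow> rvec) \<Rightarrow> (nat \<Rightarrow> real) \<Rightarrow> bool" where
  "closed_loop n p f x v \<gamma> \<longleftrightarrow>
     (\<forall>t. v t \<noteq> x t \<longrightarrow>
        \<gamma> t = min (dot (x t - v t) (gradient n f (x t)) / ((p - 1) * (lp_norm p (x t - v t))\<^sup>2)) 1)"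

text \<open>
  The weight of the vertex \<open>u\<close> in the convex decomposition of the \<open>t\<close>-th iterate that is obtained
  by unfolding \<open>x\<^sub>s\<^sub>+\<^sub>1 = (1 - \<gamma>\<^sub>s) x\<^sub>s + \<gamma>\<^sub>s v\<^sub>s\<close>; weights of coinciding vertices are added.
\<close>

primrec fw_weight ::
  "rvec \<Rightarrow> (nat \<Rightarrow> rvec) \<Rightarrow> (nat \<Rightarrow> real) \<Rightarrow> nat \<Rightarrow> rvec \<Rightarrow> real" where
  "fw_weight x0 v \<gamma> 0 u = of_bool (u = x0)"
| "fw_weight x0 v \<gamma> (Suc t) u =
     (1 - \<gamma> t) * fw_weight x0 v \<gamma> t u + \<gamma> t * of_bool (u = v t)"

definition fw_cardinality :: "rvec \<Rightarrow> (nat \<Rightarrow> rvec) \<Rightarrow> (nat \<Rightarrow> real) \<Rightarrow> nat \<Rightarrow> nat" where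
  "fw_cardinality x0 v \<gamma> t = card {u. fw_weight x0 v \<gamma> t u > 0}"

end

theory Submission
  imports Defs
begin

text \<open>
  Let \<open>r\<^sub>t = \<parallel>x\<^sub>t - x\<^sup>*\<parallel>\<^sub>p\<close> and let \<open>J\<close> be the normalized duality map of the \<open>\<ell>\<^sub>p\<close>-norm.  One
  step of the algorithm adds at most one vertex, so \<open>x\<^sub>t\<close> has cardinality at most \<open>t + 1\<close>, and it
  suffices to show \<open>r\<^sub>t = O(p / (\<alpha> t))\<close>.

  Four facts give this rate.  For \<open>p \<ge> 2\<close> the function \<open>f\<close> is \<open>(p - 1)\<close>-smooth with respect to the
  \<open>\<ell>\<^sub>p\<close>-norm, \<open>\<parallel>d + h\<parallel>\<^sup>2 \<le> \<parallel>d\<parallel>\<^sup>2 + 2 \<langle>J d, h\<rangle> + (p - 1) \<parallel>h\<parallel>\<^sup>2\<close>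
  (\<open>lp_square_smooth\<close>), and its gradient at \<open>y\<close> is \<open>J (y - x\<^sup>*)\<close> (\<open>gradient_lp_square\<close>).  The
  Frank-Wolfe gap \<open>G = \<langle>x\<^sub>t - v\<^sub>t, \<nabla>f(x\<^sub>t)\<rangle>\<close> is at least \<open>\<langle>x\<^sub>t - x\<^sup>*, \<nabla>f(x\<^sub>t)\<rangle> = r\<^sub>t\<^sup>2\<close>
  because \<open>x\<^sup>*\<close> belongs to the set, and it is at least \<open>\<alpha> / 2 \<cdot> r\<^sub>t \<parallel>x\<^sub>t - v\<^sub>t\<parallel>\<^sup>2\<close> because the set
  is strongly convex (\<open>fw_gap_strongly_convex\<close>).

  The closed-loop step size minimizes the smoothness upper bound on the segment.  So either the step is
  a full one and \<open>r\<^sub>t\<^sub>+\<^sub>1 = 0\<close>, or the two bounds on the gap give \<open>r\<^sub>t\<^sub>+\<^sub>1\<^sup>2 \<le> r\<^sub>t\<^sup>2 (1 - c r\<^sub>t)\<close> with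
  \<open>c = \<alpha> / (2 (p - 1))\<close> (\<open>fw_step_progress\<close>).  Such a sequence satisfies \<open>r\<^sub>t \<le> 2 / (c t)\<close>
  (\<open>inverse_linear_decay\<close>).  The resulting bound \<open>O(p / (\<alpha> \<epsilon>))\<close> is below the claimed one because the
  diameter term is nonnegative.
\<close>

section \<open>Smoothness of the squared p-norm in coordinates\<close>

lemma sgn_eq_nearby: "dist x u < \<bar>u\<bar> \<Longrightarrow> sgn x = sgn (u :: real)"
  by (auto simp: dist_real_def sgn_if)

lemma abs_sgn_nearby: "dist x u < \<bar>u\<bar> \<Longrightarrow> sgn u * x = \<bar>x :: real\<bar>"
  by (auto simp: dist_real_def sgn_if)

lemma has_derivative_abs_powr:
  fixes p u :: real
  assumes "p > 1"
  shows "((\<lambda>u. \<bar>u\<bar> powr p) has_real_derivative p * (sgn u * \<bar>u\<bar> powr (p - 1))) (at u)"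
proof (cases "u = 0")
  case False
  have "((\<lambda>x. sgn u * x) has_real_derivative sgn u) (at u)"
    by (auto intro!: derivative_eq_intros)
  then have "(abs has_real_derivative sgn u) (at u)"
    by (rule has_field_derivative_transform_within[where d = "\<bar>u\<bar>"])
      (use False in \<open>auto simp: abs_sgn_nearby\<close>)
  with False have "((\<lambda>u. \<bar>u\<bar> powr p) has_real_derivative p * \<bar>u\<bar> powr (p - 1) * sgn u) (at u)"
    by (intro DERIV_chain2[where f = "\<lambda>z. z powr p"] has_real_derivative_powr) auto
  then show ?thesis by (simp add: mult_ac)
next
  case True
  have "((\<lambda>h::real. \<bar>h\<bar> powr (p - 1)) \<longlongrightarrow> 0) (at 0)"
    using assms by (auto intro!: tendsto_eq_intros)
  then have "((\<lambda>h::real. (\<bar>h\<bar> powr p) / h) \<longlongrightarrow> 0) (at 0)"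
  proof (rule Lim_null_comparison[rotated])
    show "\<forall>\<^sub>F h::real in at 0. norm (\<bar>h\<bar> powr p / h) \<le> \<bar>h\<bar> powr (p - 1)"
      by (auto simp: eventually_at_filter powr_diff)
  qed
  then show ?thesis using assms by (simp add: True DERIV_def)
qed

text \<open>
  The case distinction in the derivative keeps the value \<open>1\<close> at \<open>u = 0\<close> for \<open>q = 1\<close>,
  where \<open>0 powr 0 = 0\<close> would give the wrong slope.
\<close>

lemma has_derivative_signed_powr:
  fixes q u :: real
  assumes "q \<ge> 1"
  shows "((\<lambda>u. sgn u * \<bar>u\<bar> powr q) has_real_derivative
           q * (if q = 1 then 1 else \<bar>u\<bar> powr (q - 1))) (at u)"
proof (cases "q = 1")
  case True
  have "sgn u * \<bar>u\<bar> powr 1 = u" for u :: real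
    by (simp add: sgn_mult_abs)
  then show ?thesis using True by (simp add: DERIV_ident)
next
  case q: False
  show ?thesis
  proof (cases "u = 0")
    case False
    have "((\<lambda>x. sgn u * \<bar>x\<bar> powr q) has_real_derivative
        sgn u * (q * (sgn u * \<bar>u\<bar> powr (q - 1)))) (at u)"
      using q assms by (intro DERIV_cmult has_derivative_abs_powr) auto
    then have "((\<lambda>x. sgn x * \<bar>x\<bar> powr q) has_real_derivative
        sgn u * (q * (sgn u * \<bar>u\<bar> powr (q - 1)))) (at u)"
      by (rule has_field_derivative_transform_within[where d = "\<bar>u\<bar>"])
        (use False in \<open>auto dest: sgn_eq_nearby\<close>)
    then show ?thesis using q False by (simp add: sgn_if split: if_splits)
  next
    case True
    have "((\<lambda>h::real. \<bar>h\<bar> powr (q - 1)) \<longlongrightarrow> 0) (at 0)"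
      using assms q by (auto intro!: tendsto_eq_intros)
    then have "((\<lambda>h::real. (sgn h * \<bar>h\<bar> powr q) / h) \<longlongrightarrow> 0) (at 0)"
    proof (rule Lim_null_comparison[rotated])
      show "\<forall>\<^sub>F h::real in at 0. norm (sgn h * \<bar>h\<bar> powr q / h) \<le> \<bar>h\<bar> powr (q - 1)"
        by (auto simp: eventually_at_filter powr_diff abs_mult)
    qed
    then show ?thesis using assms q by (simp add: True DERIV_def)
  qed
qed

text \<open>
  Hoelder's inequality with exponents \<open>p / (p - k)\<close> and \<open>p / k\<close>: after both power sums are
  normalized to \<open>1\<close>, Young's inequality holds term by term.  The smoothness constant uses \<open>k = 2\<close>,
  the duality between \<open>\<ell>\<^sub>p\<close> and its dual norm uses \<open>k = 1\<close>.
\<close>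

lemma Hoelder_sum_powr:
  fixes a b :: "'i \<Rightarrow> real" and p k :: real
  assumes fin: "finite I" and k: "0 < k" "k < p"
  shows "(\<Sum>i\<in>I. \<bar>a i\<bar> powr (p - k) * \<bar>b i\<bar> powr k)
     \<le> (\<Sum>i\<in>I. \<bar>a i\<bar> powr p) powr (1 - k / p) * (\<Sum>i\<in>I. \<bar>b i\<bar> powr p) powr (k / p)"
    (is "?L \<le> ?A powr _ * ?B powr _")
proof (cases "?A = 0 \<or> ?B = 0")
  case True
  then have "(\<forall>i\<in>I. a i = 0) \<or> (\<forall>i\<in>I. b i = 0)"
    using fin by (auto simp: sum_nonneg_eq_0_iff)
  then have "?L = 0" by (auto intro!: sum.neutral)
  then show ?thesis by simp
next
  case False
  then have pos: "?A > 0" "?B > 0"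
    by (simp_all add: sum_nonneg order_less_le)
  define M where "M = ?A powr (1 - k / p) * ?B powr (k / p)"
  have "\<bar>a i\<bar> powr (p - k) * \<bar>b i\<bar> powr k
      \<le> M * ((1 - k / p) * (\<bar>a i\<bar> powr p / ?A) + k / p * (\<bar>b i\<bar> powr p / ?B))" for i
  proof (cases "a i = 0 \<or> b i = 0")
    case True
    then show ?thesis using k pos by (auto simp: M_def)
  next
    case False
    have e: "p * (1 - k / p) = p - k" "p * (k / p) = k" using k by (simp_all add: field_simps)
    have "\<bar>a i\<bar> powr (p - k) * \<bar>b i\<bar> powr k
        = M * ((\<bar>a i\<bar> powr p / ?A) powr (1 - k / p) * (\<bar>b i\<bar> powr p / ?B) powr (k / p))"
      using pos k by (simp add: powr_divide powr_powr e M_def)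
    also have "\<dots> \<le> M * ((1 - k / p) * (\<bar>a i\<bar> powr p / ?A) + k / p * (\<bar>b i\<bar> powr p / ?B))"
      by (intro mult_left_mono Youngs_inequality_0) (use k pos False in \<open>auto simp: M_def\<close>)
    finally show ?thesis .
  qed
  then have "?L \<le> (\<Sum>i\<in>I. M * ((1 - k / p) * (\<bar>a i\<bar> powr p / ?A) + k / p * (\<bar>b i\<bar> powr p / ?B)))"
    by (intro sum_mono)
  also have "\<dots> = M * ((1 - k / p) * (?A / ?A) + k / p * (?B / ?B))"
    by (simp only: sum_distrib_left[symmetric] sum.distrib sum_divide_distrib[symmetric])
  also have "\<dots> = M" using pos by simp
  finally show ?thesis unfolding M_def .
qed

text \<open>
  Along the line \<open>a + t h\<close> put \<open>\<phi> = A\<^bsup>2/p\<^esup>\<close> with \<open>A(t) = \<Sum>\<bar>a\<^sub>i + t h\<^sub>i\<bar>\<^bsup>p\<^esup>\<close>.  In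
  \<open>\<phi>''\<close> the term with the square of \<open>A'\<close> has the factor \<open>2/p - 1 \<le> 0\<close>, and Hoelder's inequality
  bounds the other one by \<open>2 (p - 1) \<parallel>h\<parallel>\<^sub>p\<^sup>2\<close>.  The claim is Taylor's formula of order two.
  Positivity of \<open>A\<close> on the segment allows the chain rule through the power \<open>2/p\<close>.
\<close>

lemma lp_square_smooth_segment:
  fixes a h :: "'i \<Rightarrow> real" and p :: real and I :: "'i set"
  defines "A \<equiv> \<lambda>t. \<Sum>i\<in>I. \<bar>a i + t * h i\<bar> powr p"
  assumes fin: "finite I" and p: "p \<ge> 2"
    and pos: "\<And>t. 0 \<le> t \<Longrightarrow> t \<le> 1 \<Longrightarrow> A t > 0"
  shows "A 1 powr (2 / p) \<le> A 0 powr (2 / p)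
     + 2 * (A 0 powr (2 / p - 1) * (\<Sum>i\<in>I. sgn (a i) * \<bar>a i\<bar> powr (p - 1) * h i))
     + (p - 1) * (\<Sum>i\<in>I. \<bar>h i\<bar> powr p) powr (2 / p)"
proof -
  define w where "w = (\<lambda>u::real. if p = 2 then 1 else \<bar>u\<bar> powr (p - 2))"
  \<comment> \<open>The derivative of \<open>A\<close> is \<open>p G\<close> and that of \<open>G\<close> is \<open>(p - 1) H\<close>.\<close>
  define G where "G = (\<lambda>t. \<Sum>i\<in>I. sgn (a i + t * h i) * \<bar>a i + t * h i\<bar> powr (p - 1) * h i)"
  define H where "H = (\<lambda>t. \<Sum>i\<in>I. w (a i + t * h i) * (h i)\<^sup>2)"
  define B where "B = (\<Sum>i\<in>I. \<bar>h i\<bar> powr p)"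
  define \<phi> where "\<phi> = (\<lambda>t. A t powr (2 / p))"
  define \<phi>' where "\<phi>' = (\<lambda>t. 2 * (A t powr (2 / p - 1) * G t))"
  define \<phi>'' where "\<phi>'' = (\<lambda>t. 2 * (A t powr (2 / p - 1) * ((p - 1) * H t)
      + (2 / p - 1) * A t powr (2 / p - 2) * (p * G t) * G t))"
  have dl: "((\<lambda>t. a i + t * h i) has_real_derivative h i) (at t)" for i t
    by (auto intro!: derivative_eq_intros)
  have dA: "(A has_real_derivative p * G t) (at t)" for t
  proof -
    have "(A has_real_derivative
        (\<Sum>i\<in>I. p * (sgn (a i + t * h i) * \<bar>a i + t * h i\<bar> powr (p - 1)) * h i)) (at t)"
      unfolding A_def
      by (intro DERIV_sum DERIV_chain2[where f = "\<lambda>u. \<bar>u\<bar> powr p"] has_derivative_abs_powr dl)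
        (use p in auto)
    then show ?thesis by (simp add: G_def sum_distrib_left mult_ac)
  qed
  have dG: "(G has_real_derivative (p - 1) * H t) (at t)" for t
  proof -
    have "(G has_real_derivative
        (\<Sum>i\<in>I. ((p - 1) * (if p - 1 = 1 then 1 else \<bar>a i + t * h i\<bar> powr (p - 1 - 1)) * h i) * h i)) (at t)"
      unfolding G_def
      by (intro DERIV_sum DERIV_cmult_right DERIV_chain2[where f = "\<lambda>u. sgn u * \<bar>u\<bar> powr (p - 1)"]
          has_derivative_signed_powr dl) (use p in auto)
    then show ?thesis
      by (simp add: H_def w_def sum_distrib_left power2_eq_square algebra_simps cong: if_cong)
  qed
  have d\<phi>: "(\<phi> has_real_derivative \<phi>' t) (at t)" if "0 \<le> t" "t \<le> 1" for t
  proof -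
    have "(\<phi> has_real_derivative (2 / p * A t powr (2 / p - 1)) * (p * G t)) (at t)"
      unfolding \<phi>_def
      by (rule DERIV_chain2[where f = "\<lambda>z. z powr (2 / p)", OF has_real_derivative_powr dA])
        (use pos that in auto)
    then show ?thesis using p by (simp add: \<phi>'_def)
  qed
  have d\<phi>': "(\<phi>' has_real_derivative \<phi>'' t) (at t)" if "0 \<le> t" "t \<le> 1" for t
  proof -
    have "((\<lambda>t. A t powr (2 / p - 1)) has_real_derivative
        ((2 / p - 1) * A t powr (2 / p - 1 - 1)) * (p * G t)) (at t)"
      by (rule DERIV_chain2[where f = "\<lambda>z. z powr (2 / p - 1)", OF has_real_derivative_powr dA])
        (use pos that in auto)
    from DERIV_cmult[OF DERIV_mult[OF this dG], of 2]
    show ?thesis by (simp add: \<phi>'_def \<phi>''_def add.commute mult_ac)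
  qed
  have bound: "\<phi>'' t \<le> 2 * ((p - 1) * B powr (2 / p))" if t: "0 \<le> t" "t \<le> 1" for t
  proof -
    have "H t \<le> A t powr (1 - 2 / p) * B powr (2 / p)"
    proof (cases "p = 2")
      case True
      have "\<bar>u\<bar> powr 2 = u\<^sup>2" for u :: real using powr_realpow'[of "\<bar>u\<bar>" 2] by simp
      moreover have "B \<ge> 0" by (simp add: B_def sum_nonneg)
      ultimately show ?thesis
        using pos[OF t] by (simp add: H_def w_def B_def True)
    next
      case False
      have "H t = (\<Sum>i\<in>I. \<bar>a i + t * h i\<bar> powr (p - 2) * \<bar>h i\<bar> powr 2)"
        unfolding H_def
      proof (rule sum.cong[OF refl])
        show "w (a i + t * h i) * (h i)\<^sup>2 = \<bar>a i + t * h i\<bar> powr (p - 2) * \<bar>h i\<bar> powr 2" for i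
          using False powr_realpow'[of "\<bar>h i\<bar>" 2] by (simp add: w_def)
      qed
      then show ?thesis
        using Hoelder_sum_powr[OF fin, of 2 p "\<lambda>i. a i + t * h i" h] p False
        by (simp add: A_def B_def del: powr_numeral)
    qed
    then have "A t powr (2 / p - 1) * ((p - 1) * H t)
        \<le> A t powr (2 / p - 1) * ((p - 1) * (A t powr (1 - 2 / p) * B powr (2 / p)))"
      using p by (intro mult_left_mono) auto
    also have "\<dots> = (A t powr (2 / p - 1) * A t powr (1 - 2 / p)) * ((p - 1) * B powr (2 / p))"
      by simp
    also have "\<dots> = (p - 1) * B powr (2 / p)"
      using pos[OF t] by (simp flip: powr_add)
    finally have 1: "A t powr (2 / p - 1) * ((p - 1) * H t) \<le> (p - 1) * B powr (2 / p)" .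
    have 2: "(2 / p - 1) * A t powr (2 / p - 2) * (p * G t) * G t \<le> 0"
      using p unfolding mult.assoc by (intro mult_nonpos_nonneg mult_nonneg_nonneg[OF _ mult_nonneg_nonneg] zero_le_square) auto
    show ?thesis using add_mono[OF 1 2] unfolding \<phi>''_def by simp
  qed
  define diff where "diff = (\<lambda>m::nat. if m = 0 then \<phi> else if m = 1 then \<phi>' else \<phi>'')"
  have "\<exists>t::real. 0 < t \<and> t < 1 \<and> \<phi> 1 = (\<Sum>m<2. (diff m 0 / fact m) * 1 ^ m) + (diff 2 t / fact 2) * 1 ^ 2"
    by (rule Maclaurin) (auto simp: diff_def less_2_cases_iff d\<phi> d\<phi>')
  then obtain t where t: "0 < t" "t < 1"
    and "\<phi> 1 = (\<Sum>m<2. (diff m 0 / fact m) * 1 ^ m) + (diff 2 t / fact 2) * 1 ^ 2" by blast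
  then have "\<phi> 1 = \<phi> 0 + \<phi>' 0 + \<phi>'' t / 2" by (simp add: diff_def numeral_2_eq_2)
  with bound[of t] t have "\<phi> 1 \<le> \<phi> 0 + \<phi>' 0 + (p - 1) * B powr (2 / p)" by simp
  then show ?thesis by (simp add: \<phi>_def \<phi>'_def G_def B_def)
qed

text \<open>
  If the segment from \<open>a\<close> to \<open>a + h\<close> meets the origin, then \<open>a = - t h\<close>, and the inequality becomes
  \<open>(1 - t)\<^sup>2 \<le> t\<^sup>2 - 2 t + (p - 1)\<close> times \<open>\<parallel>h\<parallel>\<^sub>p\<^sup>2\<close>.
\<close>

lemma lp_square_smooth_sum:
  fixes a h :: "'i \<Rightarrow> real" and p :: real
  assumes fin: "finite I" and p: "p \<ge> 2"
  shows "(\<Sum>i\<in>I. \<bar>a i + h i\<bar> powr p) powr (2 / p)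
     \<le> (\<Sum>i\<in>I. \<bar>a i\<bar> powr p) powr (2 / p)
     + 2 * ((\<Sum>i\<in>I. \<bar>a i\<bar> powr p) powr (2 / p - 1) * (\<Sum>i\<in>I. sgn (a i) * \<bar>a i\<bar> powr (p - 1) * h i))
     + (p - 1) * (\<Sum>i\<in>I. \<bar>h i\<bar> powr p) powr (2 / p)"
proof (cases "\<forall>t. 0 \<le> t \<and> t \<le> 1 \<longrightarrow> (\<Sum>i\<in>I. \<bar>a i + t * h i\<bar> powr p) > 0")
  case True
  then show ?thesis using lp_square_smooth_segment[OF fin p, of a h] by simp
next
  case False
  define B where "B = (\<Sum>i\<in>I. \<bar>h i\<bar> powr p)"
  have B: "B \<ge> 0" by (simp add: B_def sum_nonneg)
  from False obtain t where t: "0 \<le> t" "t \<le> 1"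
    and "\<not> (\<Sum>i\<in>I. \<bar>a i + t * h i\<bar> powr p) > 0" by auto
  then have "(\<Sum>i\<in>I. \<bar>a i + t * h i\<bar> powr p) = 0"
    by (meson sum_nonneg powr_ge_zero order_antisym not_less)
  then have "a i + t * h i = 0" if "i \<in> I" for i
    using that fin by (simp add: sum_nonneg_eq_0_iff)
  then have a: "a i = - t * h i" if "i \<in> I" for i
    using that by (metis add.commute minus_mult_left add_eq_0_iff)
  \<comment> \<open>Rescaling by \<open>s\<close> multiplies the power sum by \<open>s powr p\<close>.\<close>
  have sc: "(s powr p * B) powr (2 / p) = s\<^sup>2 * B powr (2 / p)" if "s \<ge> 0" for s
    using that B p powr_realpow'[of s 2] by (simp add: powr_mult powr_powr)
  have "(\<Sum>i\<in>I. \<bar>a i + h i\<bar> powr p) = (1 - t) powr p * B"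
    unfolding B_def sum_distrib_left
  proof (rule sum.cong[OF refl])
    fix i assume "i \<in> I"
    then have "a i + h i = (1 - t) * h i" by (simp add: a algebra_simps)
    then have "\<bar>a i + h i\<bar> = (1 - t) * \<bar>h i\<bar>" using t by (simp add: abs_mult)
    then show "\<bar>a i + h i\<bar> powr p = (1 - t) powr p * \<bar>h i\<bar> powr p"
      using t by (simp add: powr_mult)
  qed
  then have e1: "(\<Sum>i\<in>I. \<bar>a i + h i\<bar> powr p) powr (2 / p) = (1 - t)\<^sup>2 * B powr (2 / p)"
    using t by (simp add: sc)
  have e0: "(\<Sum>i\<in>I. \<bar>a i\<bar> powr p) = t powr p * B"
    unfolding B_def sum_distrib_left
    using t by (intro sum.cong) (auto simp: a abs_mult powr_mult)
  have "(\<Sum>i\<in>I. sgn (a i) * \<bar>a i\<bar> powr (p - 1) * h i) = - (t powr (p - 1)) * B"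
    unfolding B_def sum_distrib_left
  proof (rule sum.cong[OF refl])
    fix i assume "i \<in> I"
    show "sgn (a i) * \<bar>a i\<bar> powr (p - 1) * h i = - (t powr (p - 1)) * \<bar>h i\<bar> powr p"
    proof (cases "t = 0 \<or> h i = 0")
      case True
      then show ?thesis using a[OF \<open>i \<in> I\<close>] by auto
    next
      case False
      then have "sgn (a i) * \<bar>a i\<bar> powr (p - 1) * h i = - (t powr (p - 1) * (\<bar>h i\<bar> powr (p - 1) * (sgn (h i) * h i)))"
        using t a[OF \<open>i \<in> I\<close>] by (simp add: abs_mult powr_mult sgn_mult)
      also have "sgn (h i) * h i = \<bar>h i\<bar>" by (simp add: abs_sgn mult.commute)
      also have "\<bar>h i\<bar> powr (p - 1) * \<bar>h i\<bar> = \<bar>h i\<bar> powr p"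
        using False by (simp add: powr_diff)
      finally show ?thesis by simp
    qed
  qed
  then have eg: "(\<Sum>i\<in>I. \<bar>a i\<bar> powr p) powr (2 / p - 1) * (\<Sum>i\<in>I. sgn (a i) * \<bar>a i\<bar> powr (p - 1) * h i)
      = - t * B powr (2 / p)"
  proof (cases "t = 0 \<or> B = 0")
    case False
    then have pos: "t > 0" "B > 0" using t B by auto
    have "t powr (p * (2 / p - 1)) * t powr (p - 1) = t"
      using pos p by (simp flip: powr_add add: algebra_simps)
    moreover have "B powr (2 / p - 1) * B = B powr (2 / p)" 
      using pos by (simp add: powr_diff)
    ultimately have "(t powr (p * (2 / p - 1)) * t powr (p - 1)) * (B powr (2 / p - 1) * B) = t * B powr (2 / p)"
      by simp
    moreover have "(t powr p * B) powr (2 / p - 1) = t powr (p * (2 / p - 1)) * B powr (2 / p - 1)"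
      using pos by (simp add: powr_mult powr_powr)
    ultimately show ?thesis
      using \<open>(\<Sum>i\<in>I. sgn (a i) * \<bar>a i\<bar> powr (p - 1) * h i) = - (t powr (p - 1)) * B\<close>
      by (simp add: e0 mult_ac)
  qed auto
  have "(1 - t)\<^sup>2 * B powr (2 / p)
      = t\<^sup>2 * B powr (2 / p) + 2 * (- t * B powr (2 / p)) + 1 * B powr (2 / p)"
    by (simp add: power2_eq_square algebra_simps)
  also have "\<dots> \<le> t\<^sup>2 * B powr (2 / p) + 2 * (- t * B powr (2 / p)) + (p - 1) * B powr (2 / p)"
    using p by (intro add_left_mono mult_right_mono) auto
  finally show ?thesis unfolding eg e1 unfolding e0 sc[OF t(1)] by (simp add: B_def)
qed

section \<open>The squared p-norm on the coordinate subspace and its gradient\<close>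

lemma lookup_scaleR: "Poly_Mapping.lookup (c *\<^sub>R x) i = c * Poly_Mapping.lookup (x :: rvec) i"
proof -
  have "finite {i. c * Poly_Mapping.lookup x i \<noteq> 0}"
    by (rule finite_subset[OF _ finite_lookup[of x]]) auto
  then show ?thesis by (simp add: scaleR_poly_mapping_def)
qed

lemma euclid_iff: "x \<in> euclid n \<longleftrightarrow> (\<forall>i\<ge>n. Poly_Mapping.lookup x i = 0)"
  by (force simp: euclid_def in_keys_iff not_le[symmetric])

lemma subspace_euclid: "subspace (euclid n)"
  by (auto simp: subspace_def euclid_iff lookup_add lookup_scaleR)

lemma lp_norm_euclid:
  assumes "x \<in> euclid n" 
  shows "lp_norm p x = (\<Sum>i<n. \<bar>Poly_Mapping.lookup x i\<bar> powr p) powr (1 / p)"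
proof -
  have "(\<Sum>i\<in>Poly_Mapping.keys x. \<bar>Poly_Mapping.lookup x i\<bar> powr p)
      = (\<Sum>i<n. \<bar>Poly_Mapping.lookup x i\<bar> powr p)"
    using assms by (intro sum.mono_neutral_left) (auto simp: euclid_def in_keys_iff)
  then show ?thesis by (simp add: lp_norm_def)
qed

lemma dot_euclid:
  assumes "x \<in> euclid n \<or> y \<in> euclid n"
  shows "dot x y = (\<Sum>i<n. Poly_Mapping.lookup x i * Poly_Mapping.lookup y i)"
  unfolding dot_def
  using assms by (intro sum.mono_neutral_left) (auto simp: euclid_def in_keys_iff)

lemma dot_linear_right:
  "dot g (x + y) = dot g x + dot g y" "dot g (c *\<^sub>R x) = c * dot g x"
  "dot g (x - y) = dot g x - dot g y"
proof -
  obtain n where "g \<in> euclid n"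
    using finite_nat_bounded[OF finite_keys[of g]] by (auto simp: euclid_def)
  then show "dot g (x + y) = dot g x + dot g y" "dot g (c *\<^sub>R x) = c * dot g x"
    "dot g (x - y) = dot g x - dot g y"
    by (simp_all add: dot_euclid[where n = n] lookup_add lookup_minus lookup_scaleR algebra_simps
        sum.distrib sum_subtractf sum_distrib_left)
qed

lemma dot_commute: "dot x y = dot y x"
  by (simp add: dot_def Int_commute mult.commute)

lemma norm_rvec: "norm (x :: rvec) = (\<Sum>i\<in>Poly_Mapping.keys x. \<bar>Poly_Mapping.lookup x i\<bar>)"
  by (simp add: norm_poly_mapping_def dist_poly_mapping_def)

lemma abs_lookup_le_norm: "\<bar>Poly_Mapping.lookup x i\<bar> \<le> norm (x :: rvec)"
proof (cases "i \<in> Poly_Mapping.keys x")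
  case True
  then show ?thesis unfolding norm_rvec by (intro member_le_sum) auto
qed (simp add: in_keys_iff)

lemma bounded_linear_dot: "bounded_linear (dot g)"
proof (rule bounded_linear_intro)
  show "norm (dot g h) \<le> norm h * (\<Sum>i\<in>Poly_Mapping.keys g. \<bar>Poly_Mapping.lookup g i\<bar>)" for h
  proof -
    have "\<bar>dot g h\<bar> \<le> (\<Sum>i\<in>Poly_Mapping.keys g \<inter> Poly_Mapping.keys h.
        \<bar>Poly_Mapping.lookup g i * Poly_Mapping.lookup h i\<bar>)"
      unfolding dot_def by (rule sum_abs)
    also have "\<dots> \<le> (\<Sum>i\<in>Poly_Mapping.keys g. \<bar>Poly_Mapping.lookup g i * Poly_Mapping.lookup h i\<bar>)"
      by (intro sum_mono2) auto
    also have "\<dots> \<le> (\<Sum>i\<in>Poly_Mapping.keys g. norm h * \<bar>Poly_Mapping.lookup g i\<bar>)"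
      by (intro sum_mono) (metis abs_ge_zero abs_lookup_le_norm abs_mult mult.commute mult_right_mono)
    finally show ?thesis by (simp add: sum_distrib_left)
  qed
qed (simp_all add: dot_linear_right)

lemma lp_norm_nonneg: "lp_norm p x \<ge> 0"
  by (simp add: lp_norm_def)

lemma lp_norm_eq_0_iff: "lp_norm p x = 0 \<longleftrightarrow> x = 0"
  by (auto simp: lp_norm_def sum_nonneg_eq_0_iff in_keys_iff poly_mapping_eq_iff fun_eq_iff)

lemma lp_norm_scaleR:
  assumes "p > 0"
  shows "lp_norm p (c *\<^sub>R x) = \<bar>c\<bar> * lp_norm p x"
proof (cases "c = 0")
  case False
  then have "Poly_Mapping.keys (c *\<^sub>R x) = Poly_Mapping.keys x"
    by (auto simp: in_keys_iff lookup_scaleR)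
  then show ?thesis using assms
    by (simp add: lp_norm_def lookup_scaleR abs_mult powr_mult powr_powr sum_nonneg
        flip: sum_distrib_left)
qed (simp add: lp_norm_def)

text \<open>
  The norm of the ambient type is the \<open>\<ell>\<^sub>1\<close>-norm, so this comparison turns estimates in the
  \<open>\<ell>\<^sub>p\<close>-norm into statements about derivatives and continuity.
\<close>

lemma lp_norm_le_norm:
  assumes "p \<ge> 1"
  shows "lp_norm p x \<le> norm x"
proof (cases "norm x = 0")
  case False
  have "\<bar>Poly_Mapping.lookup x i\<bar> powr p \<le> \<bar>Poly_Mapping.lookup x i\<bar> * norm x powr (p - 1)" for i
  proof (cases "Poly_Mapping.lookup x i = 0")
    case False
    then have "\<bar>Poly_Mapping.lookup x i\<bar> powr p
        = \<bar>Poly_Mapping.lookup x i\<bar> * \<bar>Poly_Mapping.lookup x i\<bar> powr (p - 1)"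
      by (simp add: powr_diff)
    also have "\<dots> \<le> \<bar>Poly_Mapping.lookup x i\<bar> * norm x powr (p - 1)"
      using assms by (intro mult_left_mono powr_mono2 abs_lookup_le_norm) auto
    finally show ?thesis .
  qed simp
  then have "(\<Sum>i\<in>Poly_Mapping.keys x. \<bar>Poly_Mapping.lookup x i\<bar> powr p)
      \<le> (\<Sum>i\<in>Poly_Mapping.keys x. \<bar>Poly_Mapping.lookup x i\<bar> * norm x powr (p - 1))"
    by (intro sum_mono)
  also have "\<dots> = norm x * norm x powr (p - 1)"
    by (simp add: norm_rvec flip: sum_distrib_right)
  also have "\<dots> = norm x powr p" using False by (simp add: powr_diff)
  finally have "lp_norm p x \<le> (norm x powr p) powr (1 / p)"
    unfolding lp_norm_def using assms by (intro powr_mono2) (auto intro: sum_nonneg)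
  then show ?thesis using assms by (simp add: powr_powr)
qed (simp add: lp_norm_def)

text \<open>
  The normalized duality map of the \<open>\<ell>\<^sub>p\<close>-norm.  It sends \<open>0\<close> to \<open>0\<close>, as the gradient of
  \<open>\<parallel>\<cdot>\<parallel>\<^sub>p\<^sup>2 / 2\<close> must, because \<open>sgn 0 = 0\<close>.
\<close>

definition lp_duality_map :: "real \<Rightarrow> rvec \<Rightarrow> rvec" where
  "lp_duality_map p d =
     Poly_Mapping.map (\<lambda>c. lp_norm p d powr (2 - p) * (sgn c * \<bar>c\<bar> powr (p - 1))) d"

lemma lookup_lp_duality_map:
  "Poly_Mapping.lookup (lp_duality_map p d) i = lp_norm p d powr (2 - p)
     * (sgn (Poly_Mapping.lookup d i) * \<bar>Poly_Mapping.lookup d i\<bar> powr (p - 1))"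
  by (simp add: lp_duality_map_def map.rep_eq when_def)

lemma lp_duality_map_euclid: "d \<in> euclid n \<Longrightarrow> lp_duality_map p d \<in> euclid n"
  by (simp add: euclid_iff lookup_lp_duality_map)

lemma lp_norm_square_euclid:
  assumes "x \<in> euclid n" "p > 0"
  shows "(lp_norm p x)\<^sup>2 = (\<Sum>i<n. \<bar>Poly_Mapping.lookup x i\<bar> powr p) powr (2 / p)"
  using assms by (simp add: lp_norm_euclid[OF assms(1)] power2_eq_square flip: powr_add)

lemma dot_lp_duality_map:
  assumes "d \<in> euclid n" "p > 0"
  shows "dot (lp_duality_map p d) h = (\<Sum>i<n. \<bar>Poly_Mapping.lookup d i\<bar> powr p) powr (2 / p - 1)
     * (\<Sum>i<n. sgn (Poly_Mapping.lookup d i) * \<bar>Poly_Mapping.lookup d i\<bar> powr (p - 1)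
          * Poly_Mapping.lookup h i)"
proof -
  have "lp_norm p d powr (2 - p) = (\<Sum>i<n. \<bar>Poly_Mapping.lookup d i\<bar> powr p) powr (2 / p - 1)"
    using assms by (simp add: lp_norm_euclid powr_powr diff_divide_distrib)
  then show ?thesis
    using assms lp_duality_map_euclid[OF assms(1), of p]
    by (simp add: dot_euclid[where n = n] lookup_lp_duality_map sum_distrib_left mult_ac)
qed

lemma lp_square_smooth:
  assumes "p \<ge> 2" "d \<in> euclid n" "h \<in> euclid n"
  shows "(lp_norm p (d + h))\<^sup>2
     \<le> (lp_norm p d)\<^sup>2 + 2 * dot (lp_duality_map p d) h + (p - 1) * (lp_norm p h)\<^sup>2"
proof -
  have "d + h \<in> euclid n" using assms subspace_euclid subspace_add by blast
  then show ?thesis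
    using assms lp_square_smooth_sum[of "{..<n}" p "Poly_Mapping.lookup d" "Poly_Mapping.lookup h"]
    by (simp add: lp_norm_square_euclid[where n = n] dot_lp_duality_map[where n = n] lookup_add)
qed

lemma dot_lp_duality_map_self:
  assumes "p > 0" "d \<in> euclid n"
  shows "dot (lp_duality_map p d) d = (lp_norm p d)\<^sup>2"
proof -
  define A where "A = (\<Sum>i<n. \<bar>Poly_Mapping.lookup d i\<bar> powr p)"
  have "sgn c * \<bar>c\<bar> powr (p - 1) * c = \<bar>c\<bar> powr p" for c :: real
    by (auto simp: powr_diff sgn_if)
  then have "dot (lp_duality_map p d) d = A powr (2 / p - 1) * A"
    using assms by (simp add: dot_lp_duality_map A_def)
  moreover have "A \<ge> 0" by (simp add: A_def sum_nonneg)
  ultimately show ?thesis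
    using assms by (cases "A = 0") (auto simp: lp_norm_square_euclid A_def[symmetric] powr_diff)
qed

lemma dot_lp_duality_map_le:
  assumes "p \<ge> 2" "d \<in> euclid n" "e \<in> euclid n"
  shows "dot (lp_duality_map p d) e \<le> lp_norm p d * lp_norm p e"
proof -
  define A where "A = (\<Sum>i<n. \<bar>Poly_Mapping.lookup d i\<bar> powr p)"
  define B where "B = (\<Sum>i<n. \<bar>Poly_Mapping.lookup e i\<bar> powr p)"
  have "sgn a * \<bar>a\<bar> powr (p - 1) * b \<le> \<bar>a\<bar> powr (p - 1) * \<bar>b\<bar> powr 1" for a b :: real
  proof -
    have "sgn a * b \<le> \<bar>b\<bar>" by (auto simp: sgn_if)
    from mult_left_mono[OF this, of "\<bar>a\<bar> powr (p - 1)"] show ?thesis by (simp add: mult_ac)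
  qed
  then have "dot (lp_duality_map p d) e \<le> A powr (2 / p - 1) *
      (\<Sum>i<n. \<bar>Poly_Mapping.lookup d i\<bar> powr (p - 1) * \<bar>Poly_Mapping.lookup e i\<bar> powr 1)"
    using assms unfolding A_def
    by (subst dot_lp_duality_map[where n = n]) (auto intro!: mult_left_mono sum_mono simp del: powr_one')
  also have "\<dots> \<le> A powr (2 / p - 1) * (A powr (1 - 1 / p) * B powr (1 / p))"
    unfolding A_def B_def using assms by (intro mult_left_mono Hoelder_sum_powr) auto
  also have "\<dots> = lp_norm p d * lp_norm p e"
    using assms by (simp add: lp_norm_euclid A_def[symmetric] B_def[symmetric] flip: powr_add mult.assoc)
  finally show ?thesis .
qed

text \<open>
  This is the convexity of \<open>\<parallel>\<cdot>\<parallel>\<^sub>p\<^sup>2 / 2\<close>, obtained from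
  \<open>\<langle>J d, e\<rangle> \<le> \<parallel>d\<parallel>\<^sub>p \<parallel>e\<parallel>\<^sub>p \<le> \<parallel>d\<parallel>\<^sub>p\<^sup>2 / 2 + \<parallel>e\<parallel>\<^sub>p\<^sup>2 / 2\<close> at \<open>e = d + h\<close>,
  where \<open>J\<close> is the duality map.
\<close>

lemma lp_square_convex:
  assumes "p \<ge> 2" "d \<in> euclid n" "h \<in> euclid n"
  shows "(lp_norm p d)\<^sup>2 + 2 * dot (lp_duality_map p d) h \<le> (lp_norm p (d + h))\<^sup>2"
proof -
  have "d + h \<in> euclid n" using assms subspace_euclid subspace_add by blast
  then have "dot (lp_duality_map p d) (d + h) \<le> lp_norm p d * lp_norm p (d + h)"
    using assms dot_lp_duality_map_le by blast
  moreover have "2 * (lp_norm p d * lp_norm p (d + h)) \<le> (lp_norm p d)\<^sup>2 + (lp_norm p (d + h))\<^sup>2"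
    using sum_squares_bound[of "lp_norm p d" "lp_norm p (d + h)"] by simp
  ultimately show ?thesis
    using dot_lp_duality_map_self[of p d n] assms by (simp add: dot_linear_right)
qed

text \<open>
  Convexity and smoothness enclose the linearization error between \<open>0\<close> and
  \<open>(p - 1) / 2 \<cdot> \<parallel>h\<parallel>\<^sub>p\<^sup>2\<close>, which gives differentiability at every point, the minimizer \<open>c\<close>
  included, without differentiating coordinatewise.
\<close>

lemma has_derivative_lp_square:
  assumes p: "p \<ge> 2" and y: "y \<in> euclid n" and c: "c \<in> euclid n"
  shows "((\<lambda>y. 1 / 2 * (lp_norm p (y - c))\<^sup>2) has_derivative dot (lp_duality_map p (y - c)))
           (at y within euclid n)"
proof (rule has_derivativeI)
  show "bounded_linear (dot (lp_duality_map p (y - c)))" by (rule bounded_linear_dot)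
  define f where "f = (\<lambda>y. 1 / 2 * (lp_norm p (y - c))\<^sup>2)"
  define g where "g = dot (lp_duality_map p (y - c))"
  have bound: "norm ((f z - f y - g (z - y)) /\<^sub>R norm (z - y)) \<le> (p - 1) / 2 * norm (z - y)"
    if z: "z \<in> euclid n" for z
  proof -
    have e: "y - c \<in> euclid n" "z - y \<in> euclid n"
      using y c z subspace_euclid subspace_diff by blast+
    have zc: "(y - c) + (z - y) = z - c" by simp
    have "0 \<le> f z - f y - g (z - y)"
      using lp_square_convex[OF p e] unfolding zc f_def g_def by simp
    moreover have "f z - f y - g (z - y) \<le> (p - 1) / 2 * (lp_norm p (z - y))\<^sup>2"
      using lp_square_smooth[OF p e] unfolding zc f_def g_def by (simp add: field_simps)
    moreover have "(p - 1) / 2 * (lp_norm p (z - y))\<^sup>2 \<le> (p - 1) / 2 * (norm (z - y))\<^sup>2"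
      using p by (intro mult_left_mono power_mono lp_norm_le_norm lp_norm_nonneg) auto
    ultimately have "\<bar>f z - f y - g (z - y)\<bar> \<le> (p - 1) / 2 * (norm (z - y))\<^sup>2" by linarith
    then show ?thesis
      by (cases "z = y") (auto simp: abs_mult divide_simps power2_eq_square)
  qed
  have "((\<lambda>z. (p - 1) / 2 * norm (z - y)) \<longlongrightarrow> 0) (at y within euclid n)"
    by (auto intro!: tendsto_eq_intros)
  then show "((\<lambda>z. ((1 / 2 * (lp_norm p (z - c))\<^sup>2) - (1 / 2 * (lp_norm p (y - c))\<^sup>2)
      - dot (lp_duality_map p (y - c)) (z - y)) /\<^sub>R norm (z - y)) \<longlongrightarrow> 0) (at y within euclid n)"
    by (rule Lim_null_comparison[rotated])
      (use bound in \<open>auto simp: eventually_at_filter f_def g_def\<close>)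
qed

text \<open>
  The lines \<open>y + t e\<^sub>i\<close> with \<open>i < n\<close> stay inside \<open>\<real>\<^sup>n\<close>, so the derivative within this subspace
  determines the coordinates below \<open>n\<close>; the others vanish by membership in the subspace.
\<close>

lemma gradient_unique:
  assumes y: "y \<in> euclid n" and g: "g \<in> euclid n" and g': "g' \<in> euclid n"
    and d: "(f has_derivative dot g) (at y within euclid n)"
    and d': "(f has_derivative dot g') (at y within euclid n)"
  shows "g = g'"
proof (rule poly_mapping_eqI)
  fix i
  show "Poly_Mapping.lookup g i = Poly_Mapping.lookup g' i"
  proof (cases "i < n")
    case True
    define e :: rvec where "e = Poly_Mapping.single i 1"
    have e: "e \<in> euclid n" using True by (simp add: e_def euclid_def)
    define l where "l = (\<lambda>t::real. y + t *\<^sub>R e)"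
    have l: "range l \<subseteq> euclid n" 
      using y e by (auto simp: l_def intro!: subspace_add[OF subspace_euclid] subspace_scale[OF subspace_euclid])
    have dl: "(l has_derivative (\<lambda>t. t *\<^sub>R e)) (at 0)"
      unfolding l_def by (auto intro!: derivative_eq_intros)
    have "((\<lambda>t. f (l t)) has_derivative (\<lambda>t. dot k (t *\<^sub>R e))) (at 0)"
      if "(f has_derivative dot k) (at y within euclid n)" for k
    proof -
      have "(f has_derivative dot k) (at (l 0) within range l)"
        using has_derivative_subset[OF that l] by (simp add: l_def)
      from has_derivative_in_compose[OF dl this] show ?thesis .
    qed
    from has_derivative_unique[OF this[OF d] this[OF d']]
    have "dot g (1 *\<^sub>R e) = dot g' (1 *\<^sub>R e)" by meson
    moreover have "dot k e = Poly_Mapping.lookup k i" for k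
      using True e by (simp add: dot_euclid[where n = n] e_def lookup_single when_def sum.delta if_distrib cong: if_cong)
    ultimately show ?thesis by simp
  next
    case False
    then show ?thesis using g g' by (simp add: euclid_iff)
  qed
qed

lemma gradient_lp_square:
  assumes "p \<ge> 2" "y \<in> euclid n" "c \<in> euclid n"
  shows "gradient n (\<lambda>y. 1 / 2 * (lp_norm p (y - c))\<^sup>2) y = lp_duality_map p (y - c)"
  unfolding gradient_def
proof (rule the_equality)
  have "y - c \<in> euclid n" using assms subspace_euclid subspace_diff by blast
  then show *: "lp_duality_map p (y - c) \<in> euclid n \<and>
      ((\<lambda>y. 1 / 2 * (lp_norm p (y - c))\<^sup>2) has_derivative (\<lambda>h. dot (lp_duality_map p (y - c)) h))
        (at y within euclid n)"
    using assms has_derivative_lp_square lp_duality_map_euclid by auto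
  show "g = lp_duality_map p (y - c)"
    if "g \<in> euclid n \<and> ((\<lambda>y. 1 / 2 * (lp_norm p (y - c))\<^sup>2) has_derivative (\<lambda>h. dot g h))
        (at y within euclid n)" for g
    using that * gradient_unique[OF assms(2)] by blast
qed

section \<open>Convergence of the closed-loop Frank-Wolfe algorithm\<close>

lemma continuous_on_lp_norm:
  assumes "p \<ge> 2"
  shows "continuous_on (euclid n) (lp_norm p)"
proof -
  have "0 \<in> euclid n" by (simp add: euclid_def)
  then have "continuous_on (euclid n) (\<lambda>y. 1 / 2 * (lp_norm p (y - 0))\<^sup>2)"
    using has_derivative_lp_square[OF assms] has_derivative_continuous
    unfolding continuous_on_eq_continuous_within by blast
  then have "continuous_on (euclid n) (\<lambda>y. sqrt (2 * (1 / 2 * (lp_norm p (y - 0))\<^sup>2)))"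
    by (rule continuous_on_real_sqrt[OF continuous_on_mult_left])
  moreover have "(\<lambda>y. sqrt (2 * (1 / 2 * (lp_norm p (y - 0))\<^sup>2))) = lp_norm p"
    by (simp add: lp_norm_nonneg)
  ultimately show ?thesis by (simp only:)
qed

text \<open>
  The diameter is a \<open>GREATEST\<close>, which has a meaningful value only if the maximum is attained; compactness
  and continuity provide this.
\<close>

lemma lp_diameter_nonneg:
  assumes p: "p \<ge> 2" and C: "C \<subseteq> euclid n" "C \<noteq> {}" "compact C"
  shows "lp_diameter p C \<ge> 0"
proof -
  define N where "N = (\<lambda>z. lp_norm p (snd z - fst z))"
  have "continuous_on (C \<times> C) N"
    unfolding N_def
    by (rule continuous_on_compose2[OF continuous_on_lp_norm[OF p, of n]])
      (use C in \<open>auto intro!: continuous_intros subspace_diff[OF subspace_euclid]\<close>)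
  then have "\<exists>z\<in>C \<times> C. \<forall>z'\<in>C \<times> C. N z' \<le> N z"
    using C by (intro continuous_attains_sup) (auto simp: compact_Times)
  then obtain z where z: "z \<in> C \<times> C" and max: "\<And>z'. z' \<in> C \<times> C \<Longrightarrow> N z' \<le> N z"
    by blast
  have "lp_diameter p C = N z"
    unfolding lp_diameter_def
  proof (rule Greatest_equality)
    show "\<exists>x\<in>C. \<exists>y\<in>C. N z = lp_norm p (y - x)" using z unfolding N_def by (metis mem_Times_iff)
    show "d \<le> N z" if "\<exists>x\<in>C. \<exists>y\<in>C. d = lp_norm p (y - x)" for d
      using that max by (force simp: N_def)
  qed
  then show ?thesis by (simp add: N_def lp_norm_nonneg)
qed

text \<open>
  Strong convexity puts the midpoint of \<open>y\<close> and \<open>v\<close>, shifted by \<open>\<alpha> / 4 \<cdot> \<parallel>y - v\<parallel>\<^sub>p\<^sup>2\<close> in any unit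
  direction, into \<open>C\<close>.  The direction \<open>- d / \<parallel>d\<parallel>\<^sub>p\<close> lowers the linear functional \<open>J d\<close> by
  \<open>\<parallel>d\<parallel>\<^sub>p\<close> per unit of length, and \<open>v\<close> does at least as well as this point.
\<close>

lemma fw_gap_strongly_convex:
  assumes p: "p > 0" and C: "strongly_convex_set n \<alpha> (lp_norm p) C"
    and mem: "y \<in> C" "v \<in> C" and d: "d \<in> euclid n"
    and v: "\<And>w. w \<in> C \<Longrightarrow> dot v (lp_duality_map p d) \<le> dot w (lp_duality_map p d)"
  shows "\<alpha> / 2 * lp_norm p d * (lp_norm p (y - v))\<^sup>2 \<le> dot (y - v) (lp_duality_map p d)"
proof (cases "lp_norm p d = 0")
  case True
  then show ?thesis using v[OF mem(1)] by (simp add: dot_commute[of _ "lp_duality_map p d"] dot_linear_right)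
next
  case False
  define g where "g = lp_duality_map p d"
  define r where "r = lp_norm p d"
  define z where "z = (- 1 / r) *\<^sub>R d"
  have r: "r > 0" using False lp_norm_nonneg[of p d] by (simp add: r_def)
  have "z \<in> euclid n" unfolding z_def by (rule subspace_scale[OF subspace_euclid d])
  moreover have "lp_norm p z = 1"
    using r p unfolding z_def by (subst lp_norm_scaleR) (simp_all add: r_def)
  moreover have "1 / 2 \<in> {0..1::real}" by simp
  ultimately have "(1 - 1 / 2) *\<^sub>R y + (1 / 2) *\<^sub>R v
      + ((1 - 1 / 2) * (1 / 2) * \<alpha> * (lp_norm p (y - v))\<^sup>2) *\<^sub>R z \<in> C" (is "?w \<in> C")
    using C mem unfolding strongly_convex_set_def by blast
  from v[OF this] have "dot g v \<le> dot g ?w" by (simp add: g_def dot_commute)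
  moreover have "dot g z = - r"
    using dot_lp_duality_map_self[of p d n] p d r
    unfolding z_def dot_linear_right(2) by (simp add: g_def r_def power2_eq_square)
  ultimately have "\<alpha> / 2 * r * (lp_norm p (y - v))\<^sup>2 \<le> dot g y - dot g v"
    unfolding dot_linear_right by (simp add: algebra_simps)
  then show ?thesis
    by (simp add: g_def r_def dot_commute[of _ "lp_duality_map p d"] dot_linear_right)
qed

text \<open>
  Write \<open>r\<close> for the distance of \<open>y\<close> to \<open>c\<close>, \<open>N\<close> for \<open>\<parallel>y - v\<parallel>\<^sub>p\<close> and \<open>G\<close> for the
  Frank-Wolfe gap.  The step size minimizes the smoothness bound \<open>r\<^sup>2 - 2 \<gamma> G + (p - 1) \<gamma>\<^sup>2 N\<^sup>2\<close> over
  \<open>[0, 1]\<close>.  A full step reaches \<open>c\<close> exactly, since then \<open>(p - 1) N\<^sup>2 \<le> G\<close> and \<open>r\<^sup>2 \<le> G\<close>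
  make the bound nonpositive.  A shorter step decreases \<open>r\<^sup>2\<close> by at least \<open>G\<^sup>2 / ((p - 1) N\<^sup>2)\<close>; bounding one
  factor \<open>G\<close> by \<open>r\<^sup>2\<close> and the other by \<open>\<alpha> r N\<^sup>2 / 2\<close> removes \<open>N\<close>.
\<close>

lemma fw_step_progress:
  assumes p: "p \<ge> 2" and C: "C \<subseteq> euclid n" "strongly_convex_set n \<alpha> (lp_norm p) C"
    and mem: "y \<in> C" "v \<in> C" "c \<in> C"
    and g: "g = lp_duality_map p (y - c)"
    and v: "\<And>w. w \<in> C \<Longrightarrow> dot v g \<le> dot w g"
    and \<gamma>: "v \<noteq> y \<Longrightarrow> \<gamma> = min (dot (y - v) g / ((p - 1) * (lp_norm p (y - v))\<^sup>2)) 1"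
  shows "lp_norm p (y + \<gamma> *\<^sub>R (v - y) - c) = 0 \<or>
    (lp_norm p (y + \<gamma> *\<^sub>R (v - y) - c))\<^sup>2
      \<le> (lp_norm p (y - c))\<^sup>2 * (1 - \<alpha> / (2 * (p - 1)) * lp_norm p (y - c))"
proof -
  define r where "r = lp_norm p (y - c)"
  define r' where "r' = lp_norm p (y + \<gamma> *\<^sub>R (v - y) - c)"
  define N where "N = lp_norm p (y - v)"
  define G where "G = dot (y - v) g"
  have \<alpha>: "\<alpha> > 0" using C(2) by (simp add: strongly_convex_set_def)
  have r: "r \<ge> 0" by (simp add: r_def lp_norm_nonneg)
  have e: "y - c \<in> euclid n" "v - y \<in> euclid n"
    using mem C subspace_euclid subspace_diff by blast+
  have G: "G = dot g y - dot g v"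
    by (simp add: G_def dot_commute[of _ g] dot_linear_right)
  have gap_dist: "r\<^sup>2 \<le> G"
  proof -
    have "r\<^sup>2 = dot g (y - c)" using dot_lp_duality_map_self[of p "y - c" n] p e by (simp add: r_def g)
    also have "\<dots> \<le> G" using v[OF mem(3)] by (simp add: G dot_linear_right dot_commute[of _ g])
    finally show ?thesis .
  qed
  have gap_curv: "\<alpha> / 2 * r * N\<^sup>2 \<le> G"
    unfolding r_def N_def G_def g
    by (rule fw_gap_strongly_convex[OF _ C(2) mem(1,2) e(1) v[unfolded g]]) (use p in auto)
  have descent: "r'\<^sup>2 \<le> r\<^sup>2 - 2 * \<gamma> * G + (p - 1) * (\<gamma>\<^sup>2 * N\<^sup>2)"
  proof -
    have "r' = lp_norm p ((y - c) + \<gamma> *\<^sub>R (v - y))" by (simp add: r'_def algebra_simps)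
    moreover have "lp_norm p (v - y) = N"
      using lp_norm_scaleR[of p "- 1" "y - v"] p by (simp add: N_def)
    moreover have "dot g (v - y) = - G" by (simp add: G dot_linear_right)
    ultimately show ?thesis
      using lp_square_smooth[OF p e(1) subspace_scale[OF subspace_euclid e(2)], of \<gamma>] p
      by (simp add: r_def g[symmetric] mult.assoc dot_linear_right lp_norm_scaleR power_mult_distrib)
  qed
  have "r' = 0 \<or> r'\<^sup>2 \<le> r\<^sup>2 * (1 - \<alpha> / (2 * (p - 1)) * r)"
  proof (cases "G / ((p - 1) * N\<^sup>2) < 1 \<and> N > 0")
    case True
    then have "v \<noteq> y" by (auto simp: N_def lp_norm_def)
    then have \<gamma>_eq: "\<gamma> = G / ((p - 1) * N\<^sup>2)" using \<gamma> True by (simp add: G_def N_def)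
    have 1: "r'\<^sup>2 \<le> r\<^sup>2 - G * (G / ((p - 1) * N\<^sup>2))"
    proof -
      have "\<gamma> * ((p - 1) * N\<^sup>2) = G" using True p by (simp add: \<gamma>_eq)
      then have "(p - 1) * (\<gamma>\<^sup>2 * N\<^sup>2) = \<gamma> * G" by (simp add: power2_eq_square mult_ac)
      with descent show ?thesis by (simp add: \<gamma>_eq[symmetric] mult_ac)
    qed
    have 2: "r\<^sup>2 * (\<alpha> / 2 * r * N\<^sup>2 / ((p - 1) * N\<^sup>2)) \<le> G * (G / ((p - 1) * N\<^sup>2))"
      by (intro mult_mono divide_right_mono gap_dist gap_curv)
        (use gap_dist r \<alpha> p in \<open>auto intro: order_trans[OF zero_le_power2 gap_dist]\<close>)
    have 3: "\<alpha> / 2 * r * N\<^sup>2 / ((p - 1) * N\<^sup>2) = \<alpha> / (2 * (p - 1)) * r"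
      using True p by (simp add: field_simps)
    have "r'\<^sup>2 \<le> r\<^sup>2 - r\<^sup>2 * (\<alpha> / (2 * (p - 1)) * r)"
      using 1 2[unfolded 3] by (meson diff_left_mono order_trans)
    then show ?thesis by (simp add: right_diff_distrib)
  next
    case False
    \<comment> \<open>The remaining cases are the full step and the stationary case \<open>v = y\<close>, in which the gap is zero.\<close>
    have "r'\<^sup>2 \<le> 0"
    proof (cases "v = y")
      case True
      then have "r\<^sup>2 \<le> 0" using gap_dist by (simp add: G)
      moreover have "r' = r" by (simp add: r'_def r_def True)
      ultimately show ?thesis by simp
    next
      case vy: False
      have "N > 0"
      proof -
        have "N \<noteq> 0" using vy by (auto simp: N_def lp_norm_eq_0_iff)
        then show ?thesis using lp_norm_nonneg[of p "y - v"] by (simp add: N_def)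
      qed
      then have "\<gamma> = 1" "(p - 1) * N\<^sup>2 \<le> G"
        using False \<gamma>[OF vy] p by (auto simp: G_def N_def field_simps not_less)
      moreover from this descent have "r'\<^sup>2 \<le> r\<^sup>2 - 2 * G + (p - 1) * N\<^sup>2" by simp
      ultimately show ?thesis using gap_dist by linarith
    qed
    then show ?thesis by simp
  qed
  then show ?thesis by (simp add: r_def r'_def)
qed

text \<open>
  From \<open>(1 - u) (1 + u/2)\<^sup>2 \<le> 1\<close> with \<open>u = c r\<^sub>t\<close> one gets
  \<open>r\<^sub>t\<^sub>+\<^sub>1 (1 + c r\<^sub>t / 2) \<le> r\<^sub>t\<close>, so \<open>1 / r\<^sub>t\<close> grows by at least \<open>c / 2\<close>
  in every step until \<open>r\<^sub>t\<close> vanishes.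
\<close>

lemma inverse_linear_decay:
  fixes r :: "nat \<Rightarrow> real" and c :: real
  assumes c: "c \<ge> 0" and nonneg: "\<And>t. r t \<ge> 0"
    and step: "\<And>t. r (Suc t) = 0 \<or> (r (Suc t))\<^sup>2 \<le> (r t)\<^sup>2 * (1 - c * r t)"
  shows "r t * (c * real t) \<le> 2"
proof (induction t)
  case (Suc t)
  show ?case
  proof (cases "r (Suc t) = 0")
    case False
    then have pos: "r (Suc t) > 0" using nonneg[of "Suc t"] by simp
    define u where "u = c * r t"
    have u: "u \<ge> 0" using c nonneg by (simp add: u_def)
    have sq: "(r (Suc t))\<^sup>2 \<le> (r t)\<^sup>2 * (1 - u)" using step[of t] False by (simp add: u_def)
    have "(r (Suc t) * (1 + u / 2))\<^sup>2 \<le> (r t)\<^sup>2 * ((1 - u) * (1 + u / 2)\<^sup>2)"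
      using mult_right_mono[OF sq, of "(1 + u / 2)\<^sup>2"] by (simp add: power_mult_distrib mult_ac)
    also have "(1 - u) * (1 + u / 2)\<^sup>2 = 1 - 3 / 4 * u\<^sup>2 - u ^ 3 / 4"
      by (simp add: power2_eq_square power3_eq_cube field_split_simps)
    also have "(r t)\<^sup>2 * (1 - 3 / 4 * u\<^sup>2 - u ^ 3 / 4) \<le> (r t)\<^sup>2 * 1"
    proof (rule mult_left_mono)
      have "0 \<le> u\<^sup>2" "0 \<le> u ^ 3" using u by simp_all
      then show "1 - 3 / 4 * u\<^sup>2 - u ^ 3 / 4 \<le> 1" by linarith
    qed simp
    finally have "(r (Suc t) * (1 + u / 2))\<^sup>2 \<le> (r t)\<^sup>2" by (simp only: mult_1_right)
    then have le: "r (Suc t) * (1 + u / 2) \<le> r t"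
      by (rule power2_le_imp_le) (rule nonneg)
    have "0 < r (Suc t) * (1 + u / 2)" using pos u by (intro mult_pos_pos) auto
    with le have "r t > 0" by linarith
    have "c * real (Suc t) \<le> 2 * (1 + u / 2) / r t"
      using Suc.IH \<open>r t > 0\<close> by (simp add: u_def field_simps)
    also have "\<dots> \<le> 2 / r (Suc t)"
      using le pos \<open>r t > 0\<close> by (simp add: field_simps)
    finally show ?thesis using pos by (simp add: field_simps)
  qed simp
qed simp

lemma fw_cardinality_le: "fw_cardinality x0 v \<gamma> t \<le> Suc t"
proof -
  have support: "{u. fw_weight x0 v \<gamma> t u \<noteq> 0} \<subseteq> insert x0 (v ` {..<t})"
  proof (induction t)
    case (Suc t)
    then show ?case by (auto simp: lessThan_Suc split: if_splits)
  qed auto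
  then have "fw_cardinality x0 v \<gamma> t \<le> card (insert x0 (v ` {..<t}))"
    unfolding fw_cardinality_def by (intro card_mono) (force+)
  also have "\<dots> \<le> Suc t"
    using card_image_le[of "{..<t}" v] by (intro order_trans[OF card_insert_le_m1]) auto
  finally show ?thesis .
qed

lemma fw_iterate_mem:
  assumes "convex C" "frank_wolfe_run n C f x v \<gamma>"
  shows "x t \<in> C"
proof (induction t)
  case 0
  then show ?case using assms by (simp add: frank_wolfe_run_def extreme_point_of_def)
next
  case (Suc t)
  have "v t \<in> C" "0 \<le> \<gamma> t" "\<gamma> t \<le> 1" "x (Suc t) = (1 - \<gamma> t) *\<^sub>R x t + \<gamma> t *\<^sub>R v t"
    using assms by (auto simp: frank_wolfe_run_def extreme_point_of_def algebra_simps)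
  then show ?case using Suc convexD_alt[OF assms(1)] by simp
qed

lemma fw_rate:
  assumes p: "2 \<le> p" and C: "C \<subseteq> euclid n" "convex C" "strongly_convex_set n \<alpha> (lp_norm p) C"
    and c: "c \<in> C" and f: "f = (\<lambda>y. 1 / 2 * (lp_norm p (y - c))\<^sup>2)"
    and run: "frank_wolfe_run n C f x v \<gamma>" and loop: "closed_loop n p f x v \<gamma>"
  shows "lp_norm p (x t - c) * (\<alpha> / (2 * (p - 1)) * real t) \<le> 2"
proof (rule inverse_linear_decay)
  show "0 \<le> \<alpha> / (2 * (p - 1))" using C(3) p by (simp add: strongly_convex_set_def)
  show "lp_norm p (x t - c) \<ge> 0" for t by (rule lp_norm_nonneg)
  fix t
  have x: "x t \<in> C" using C(2) run by (rule fw_iterate_mem)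
  have grad: "gradient n f (x t) = lp_duality_map p (x t - c)"
    unfolding f using p x c C by (intro gradient_lp_square) auto
  have v: "v t \<in> C" "x (Suc t) = x t + \<gamma> t *\<^sub>R (v t - x t)"
    and min: "is_arg_min (\<lambda>w. dot w (gradient n f (x t))) (\<lambda>w. w \<in> C) (v t)"
    using run by (auto simp: frank_wolfe_run_def extreme_point_of_def)
  have v_le: "dot (v t) (gradient n f (x t)) \<le> dot w (gradient n f (x t))" if "w \<in> C" for w
    using min that by (auto simp: is_arg_min_linorder)
  have \<gamma>: "\<gamma> t = min (dot (x t - v t) (gradient n f (x t)) / ((p - 1) * (lp_norm p (x t - v t))\<^sup>2)) 1"
    if "v t \<noteq> x t"
    using loop that by (simp add: closed_loop_def)
  show "lp_norm p (x (Suc t) - c) = 0 \<or>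
      (lp_norm p (x (Suc t) - c))\<^sup>2
        \<le> (lp_norm p (x t - c))\<^sup>2 * (1 - \<alpha> / (2 * (p - 1)) * lp_norm p (x t - c))"
    unfolding v(2) by (rule fw_step_progress[OF p C(1,3) x v(1) c grad v_le \<gamma>])
qed

theorem corollary5p4:
  "\<exists>K::real. K > 0 \<and>
     (\<forall>(n::nat) (p::real) (\<alpha>::real) (\<epsilon>::real) (C::rvec set) (xstar::rvec) (f::rvec \<Rightarrow> real)
        (x::nat \<Rightarrow> rvec) (v::nat \<Rightarrow> rvec) (\<gamma>::nat \<Rightarrow> real).
        2 \<le> p \<and> 0 < \<alpha> \<and> 0 < \<epsilon> \<and>
        C \<subseteq> euclid n \<and> C \<noteq> {} \<and> compact C \<and> convex C \<and>
        strongly_convex_set n \<alpha> (lp_norm p) C \<and>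
        xstar \<in> C \<and>
        f = (\<lambda>y. 1 / 2 * (lp_norm p (y - xstar))\<^sup>2) \<and>
        frank_wolfe_run n C f x v \<gamma> \<and>
        closed_loop n p f x v \<gamma>
        \<longrightarrow>
        (\<exists>t. x t \<in> C \<and> lp_norm p (x t - xstar) \<le> \<epsilon> \<and>
             real (fw_cardinality (x 0) v \<gamma> t)
               \<le> K * max 1 ((sqrt p * lp_diameter p C + p / \<alpha>) / \<epsilon>)))"
proof (rule exI[of _ 6], intro conjI allI impI)
  fix n :: nat and p \<alpha> \<epsilon> :: real and C :: "rvec set" and xstar :: rvec
    and f :: "rvec \<Rightarrow> real" and x v :: "nat \<Rightarrow> rvec" and \<gamma> :: "nat \<Rightarrow> real"
  assume asm: "2 \<le> p \<and> 0 < \<alpha> \<and> 0 < \<epsilon> \<and>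
        C \<subseteq> euclid n \<and> C \<noteq> {} \<and> compact C \<and> convex C \<and>
        strongly_convex_set n \<alpha> (lp_norm p) C \<and>
        xstar \<in> C \<and>
        f = (\<lambda>y. 1 / 2 * (lp_norm p (y - xstar))\<^sup>2) \<and>
        frank_wolfe_run n C f x v \<gamma> \<and>
        closed_loop n p f x v \<gamma>"
  then have pos: "2 \<le> p" "0 < \<alpha>" "0 < \<epsilon>" by blast+
  \<comment> \<open>By the rate, \<open>4 (p - 1) / (\<alpha> t) \<le> \<epsilon>\<close> suffices.\<close>
  define t where "t = nat \<lceil>4 * (p / \<alpha> / \<epsilon>)\<rceil>"
  have t: "4 * (p / \<alpha> / \<epsilon>) \<le> real t" "real t \<le> 4 * (p / \<alpha> / \<epsilon>) + 1"
    using pos by (simp_all add: t_def)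
  have "0 < 4 * (p / \<alpha> / \<epsilon>)" using pos by simp
  with t(1) have "real t > 0" by linarith
  have "lp_norm p (x t - xstar) * (\<alpha> / (2 * (p - 1)) * real t) \<le> 2"
    using asm fw_rate by blast
  moreover have "2 \<le> \<epsilon> * (\<alpha> / (2 * (p - 1)) * real t)"
    using t(1) pos by (simp add: field_simps)
  ultimately have "lp_norm p (x t - xstar) * (\<alpha> / (2 * (p - 1)) * real t)
      \<le> \<epsilon> * (\<alpha> / (2 * (p - 1)) * real t)" by linarith
  then have "lp_norm p (x t - xstar) \<le> \<epsilon>"
    using pos \<open>real t > 0\<close> by (subst (asm) mult_le_cancel_right_pos) auto
  moreover have "x t \<in> C" using asm fw_iterate_mem by blast
  moreover have "real (fw_cardinality (x 0) v \<gamma> t)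
      \<le> 6 * max 1 ((sqrt p * lp_diameter p C + p / \<alpha>) / \<epsilon>)"
  proof -
    have "lp_diameter p C \<ge> 0" using asm lp_diameter_nonneg by blast
    then have "p / \<alpha> / \<epsilon> \<le> (sqrt p * lp_diameter p C + p / \<alpha>) / \<epsilon>"
      using pos by (intro divide_right_mono) auto
    moreover have "real (fw_cardinality (x 0) v \<gamma> t) \<le> real t + 1"
      using fw_cardinality_le[of "x 0" v \<gamma> t] by linarith
    \<comment> \<open>The cardinality is at most \<open>t + 1 \<le> 4 M + 2 \<le> 6 M\<close>, where \<open>M\<close> is the maximum in the claim.\<close>
    ultimately show ?thesis using t(2) by linarith
  qed
  ultimately show "\<exists>t. x t \<in> C \<and> lp_norm p (x t - xstar) \<le> \<epsilon> \<and>
      real (fw_cardinality (x 0) v \<gamma> t)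
        \<le> 6 * max 1 ((sqrt p * lp_diameter p C + p / \<alpha>) / \<epsilon>)" by blast
qed simp

end
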